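(* Let $\boldsymbol{x}$-notation, the game, the operator $\mathbb{F}$, the solution set $\mathrm{SOL}(\boldsymbol\Omega,\mathbb{F},G)$, and the iterates $(\boldsymbol x^k)_{k\in\mathbb{N}}$ with single-sample approximation $F_{\mathrm{SA}}$, stochastic error $\epsilon^k$, filtration $(\mathcal F^k)_{k\in\mathbb N}$ and step sizes $\gamma_k>0$ be as in the context. Let $\boldsymbol x^*\in \mathrm{SOL}(\boldsymbol\Omega,\mathbb{F},G)$ and suppose that: (i) for all $k\ge 0$, $\mathbb{E}[\epsilon^k\mid\mathcal F^k]=0$ almost surely; (ii) $\sum_{k=0}^\infty\gamma_k=\infty$, $\sum_{k=0}^\infty\gamma_k^2<\infty$, and $\sum_{k=0}^\infty\gamma_k^2\,\mathbb{E}[\|\epsilon^k\|^2\mid\mathcal F^k]<\infty$ almost surely; (iii) (restricted strong monotonicity) there is $\mu>0$ such that $\langle \mathbb{F}(\boldsymbol x)-\mathbb{F}(\boldsymbol x^* ),\boldsymbol x-\boldsymbol x^*\rangle\ge\mu\|\boldsymbol x-\boldsymbol x^*\|^2$ for all $\boldsymbol x\in\boldsymbol\Omega$; (iv) (restricted Lipschitz continuity) there is $\ell>0$ such that $\|\mathbb{F}(\boldsymbol x)-\mathbb{F}(\boldsymbol x^* )\|\le\ell\|\boldsymbol x-\boldsymbol x^*\|$ for all $\boldsymbol x\in\boldsymbol\Omega$. Then $(\boldsymbol x^k)_{k\in\mathbb{N}}$ converges almost surely to a variational stochastic Nash equilibrium (v-SNE) of the game, i.e. to an element of $\mathrm{S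OL}(\boldsymbol\Omega,\mathbb{F},G)$.
   Context: Game. Let $\mathcal I=\{1,\dots,N\}$ be a set of agents. Agent $i$ has decision variable $x_i\in\Omega_i\subseteq\mathbb{R}^{n_i}$; $n=\sum_i n_i$, $\boldsymbol x=\mathrm{col}(x_1,\dots,x_N)\in\boldsymbol\Omega=\Omega_1\times\dots\times\Omega_N\subseteq\mathbb{R}^n$, and $\boldsymbol x_{-i}=\mathrm{col}(\{x_j\}_{j\ne i})\in\boldsymbol\Omega_{-i}=\prod_{j\neq i}\Omega_j$. Here $\mathrm{col}$ denotes stacking into a column vector; $\langle\cdot,\cdot\rangle$ and $\|\cdot\|$ are the Euclidean inner product and norm. The cost of agent $i$ is $\mathbb{J}_i(x_i,\boldsymbol x_{-i})=\mathbb{E}[f_i(x_i,\boldsymbol x_{-i},\xi_i)]+g_i(x_i)$, where $\xi_i$ is an $\mathbb{R}^d$-valued random variable, $f_i:\mathbb{R}^n\times\mathbb{R}^d\to\mathbb{R}$ and $g_i:\mathbb{R}^{n_i}\to\mathbb{R}\cup\{+\infty\}$. The game is: each agent $i$ solves $\min_{x_i\in\Omega_i}\mathbb{J}_i(x_i,\boldsymbol x_{-i})$. Standing assumptions. For each $i$ and $\boldsymbol x_{-i}\in\boldsymbol\Omega_{-i}$, the expected-value function $x_i\mapsto\mathbb{E}[f_i(x_i,\boldsymbol x_{-i},\xi_i)]$ is convex and continuously differentiable. For each $i$, each $\boldsymbol x_{-i}\in\boldsymbol\Omega_{-i}$ and each value $\xi$, the function $f_i(\cdot,\boldsymbol x_{-i},\xi)$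 is convex, Lipschitz continuous with constant $\ell_i(\boldsymbol x_{-i},\xi)$, and continuously differentiable; $f_i(x_i,\boldsymbol x_{-i},\cdot)$ is measurable, and $\ell_i(\boldsymbol x_{-i},\xi)$ is integrable in $\xi$ for each $\boldsymbol x_{-i}\in\boldsymbol\Omega_{-i}$. For each $i$, $g_i$ is lower semicontinuous and convex and $\mathrm{dom}(g_i)=\Omega_i$ is nonempty, compact and convex. Pseudogradient and v-SNE. $\mathbb{F}(\boldsymbol x)=\mathrm{col}\big((\mathbb{E}[\nabla_{x_i}f_i(x_i,\boldsymbol x_{-i},\xi_i)])_{i\in\mathcal I}\big)$ and $G(\boldsymbol x)=\partial g_1(x_1)\times\dots\times\partial g_N(x_N)$. $\mathrm{SOL}(\boldsymbol\Omega,\mathbb{F},G)$ is the set of $\boldsymbol x^*\in\boldsymbol\Omega$ such that $\langle\mathbb{F}(\boldsymbol x^* ),\boldsymbol x-\boldsymbol x^*\rangle+\sum_{i\in\mathcal I}\{g_i(x_i)-g_i(x_i^* )\}\ge0$ for all $\boldsymbol x\in\boldsymbol\Omega$; its elements are called variational stochastic Nash equilibria (v-SNE) of the game. Algorithm (distributed stochastic forward–backward). Start from $x_i^0\in\Omega_i$ for all $i$, and for $k\ge0$ and all $i\in\mathcal I$ set $$x_i^{k+1}=\mathrm{prox}_{\gamma_k g_i}\big[x_i^k-\gamma_k\hat F_i(\boldsymbol x^k,\boldsymbol\xi^k)\big],$$ where $\mathrm{prox}_{g}(v)=\mathrm{argmin}_u\{g(u)+\tfrac12\|u-v\|^2\}$,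 $(\gamma_k)_{k\in\mathbb N}$ are positive step sizes, and $\hat F_i$ is the $i$-th block of the approximation $\hat F=F_{\mathrm{SA}}$ with $$F_{\mathrm{SA}}(\boldsymbol x^k,\boldsymbol\xi^k)=\mathrm{col}\big(\nabla_{x_1}f_1(\boldsymbol x^k,\xi_1^k),\dots,\nabla_{x_N}f_N(\boldsymbol x^k,\xi_N^k)\big),$$ where $\boldsymbol\xi^k=\mathrm{col}(\xi_1^k,\dots,\xi_N^k)$, $k\ge0$, are i.i.d. samples of $\mathrm{col}(\xi_1,\dots,\xi_N)$. The stochastic error is $\epsilon^k=F_{\mathrm{SA}}(\boldsymbol x^k,\boldsymbol\xi^k)-\mathbb{F}(\boldsymbol x^k)$. $\mathcal F^k$ is the $\sigma$-algebra generated by $\boldsymbol x^0,\boldsymbol\xi^0,\dots,\boldsymbol\xi^{k-1}$ (so $\boldsymbol x^k$ is $\mathcal F^k$-measurable). *)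

theory Defs
  imports "HOL-Probability.Probability"
begin

text \<open>
  The decision space of all agents is \<open>real ^ 'n\<close>, and the agents are the elements of the
  finite type \<open>'i\<close>. A map \<open>own :: 'n \<Rightarrow> 'i\<close> says which agent owns which coordinate, so that agent
  \<open>i\<close> has \<open>card {c. own c = i}\<close> decision variables. The decision space of agent \<open>i\<close> is represented
  by the coordinate subspace of the vectors that vanish outside the coordinates of \<open>i\<close>. The norm
  and inner product inherited from \<open>real ^ 'n\<close> are the Euclidean ones, and \<open>col\<close> of vectors from
  the individual blocks is their sum. Every \<open>x\<close> is \<open>part own i x + rest own i x\<close>, which are the
  decision of \<open>i\<close> and that of the other agents.
\<close>

definition block :: "('n::finite \<Rightarrow> 'i) \<Rightarrow> 'i \<Rightarrow> (real ^ 'n) set" where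
  "block own i = {u. \<forall>c. own c \<noteq> i \<longrightarrow> u $ c = 0}"

definition part :: "('n::finite \<Rightarrow> 'i) \<Rightarrow> 'i \<Rightarrow> real ^ 'n \<Rightarrow> real ^ 'n" where
  "part own i x = (\<chi> c. if own c = i then x $ c else 0)"

definition rest :: "('n::finite \<Rightarrow> 'i) \<Rightarrow> 'i \<Rightarrow> real ^ 'n \<Rightarrow> real ^ 'n" where
  "rest own i x = (\<chi> c. if own c = i then 0 else x $ c)"

definition joint_set :: "('n::finite \<Rightarrow> 'i) \<Rightarrow> ('i \<Rightarrow> (real ^ 'n) set) \<Rightarrow> (real ^ 'n) set" where
  "joint_set own \<Omega> = {x. \<forall>i. part own i x \<in> \<Omega> i}"

definition others_set :: "('n::finite \<Rightarrow> 'i) \<Rightarrow> ('i \<Rightarrow> (real ^ 'n) set) \<Rightarrow> 'i \<Rightarrow> (real ^ 'n) set" where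
  "others_set own \<Omega> i = {y. part own i y = 0 \<and> (\<forall>j. j \<noteq> i \<longrightarrow> part own j y \<in> \<Omega> j)}"

text \<open>
  Differentiability of a function on a linear subspace \<open>V\<close>. The gradient is required to lie in
  \<open>V\<close>, which makes it unique.
\<close>

definition has_gradient_on ::
    "('a::real_inner \<Rightarrow> real) \<Rightarrow> 'a \<Rightarrow> 'a set \<Rightarrow> 'a \<Rightarrow> bool" where
  "has_gradient_on \<phi> D V u \<longleftrightarrow> D \<in> V \<and> (\<phi> has_derivative (\<lambda>h. D \<bullet> h)) (at u within V)"

definition gradient_on :: "('a::real_inner \<Rightarrow> real) \<Rightarrow> 'a set \<Rightarrow> 'a \<Rightarrow> 'a" where
  "gradient_on \<phi> V u = (THE D. has_gradient_on \<phi> D V u)"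

definition C1_on :: "'a::real_inner set \<Rightarrow> ('a \<Rightarrow> real) \<Rightarrow> bool" where
  "C1_on V \<phi> \<longleftrightarrow> (\<exists>D. (\<forall>u\<in>V. has_gradient_on \<phi> (D u) V u) \<and> continuous_on V D)"

lemma has_gradient_on_unique:
  assumes V: "subspace V" and u: "u \<in> V"
    and D: "has_gradient_on \<phi> D V u" and E: "has_gradient_on \<phi> E V u"
  shows "D = E"
proof (rule ccontr)
  assume "D \<noteq> E"
  define v where "v = D - E"
  have v: "v \<in> V" "v \<noteq> 0"
    using D E V \<open>D \<noteq> E\<close> by (auto simp: v_def has_gradient_on_def subspace_diff)
  have deriv: "((\<lambda>t. \<phi> (u + t *\<^sub>R v)) has_derivative (\<lambda>t. G \<bullet> (t *\<^sub>R v))) (at 0)"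
    if "has_gradient_on \<phi> G V u" for G
  proof -
    have sub: "(\<lambda>t::real. u + t *\<^sub>R v) ` UNIV \<subseteq> V"
      using V u v by (auto simp: subspace_add subspace_scale)
    have g: "((\<lambda>t::real. u + t *\<^sub>R v) has_derivative (\<lambda>t. t *\<^sub>R v)) (at 0)"
      by (auto intro!: derivative_eq_intros)
    have "(\<phi> has_derivative (\<lambda>h. G \<bullet> h)) (at (u + 0 *\<^sub>R v) within (\<lambda>t::real. u + t *\<^sub>R v) ` UNIV)"
      using that sub by (auto simp: has_gradient_on_def intro: has_derivative_subset)
    from has_derivative_in_compose[OF g this] show ?thesis by simp
  qed
  have "(\<lambda>t. D \<bullet> (t *\<^sub>R v)) = (\<lambda>t. E \<bullet> (t *\<^sub>R v))"
    using deriv[OF D] deriv[OF E] by (rule has_derivative_unique)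
  from fun_cong[OF this, of 1] have "v \<bullet> v = 0"
    by (simp add: v_def inner_diff_left)
  with v show False by simp
qed

lemma gradient_on_eq:
  assumes "subspace V" "u \<in> V" "has_gradient_on \<phi> D V u"
  shows "gradient_on \<phi> V u = D"
  unfolding gradient_on_def using assms has_gradient_on_unique by (blast intro: the_equality)

definition partial_grad ::
    "('n::finite \<Rightarrow> 'i) \<Rightarrow> 'i \<Rightarrow> (real ^ 'n \<Rightarrow> real) \<Rightarrow> real ^ 'n \<Rightarrow> real ^ 'n" where
  "partial_grad own i \<phi> x =
     gradient_on (\<lambda>u. \<phi> (u + rest own i x)) (block own i) (part own i x)"

text \<open>Convexity (with \<open>0 \<cdot> \<infinity> = 0\<close>) and lower semicontinuity of extended-valued functions.\<close>

definition convex_ereal_on :: "'a::real_vector set \<Rightarrow> ('a \<Rightarrow> ereal) \<Rightarrow> bool" where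
  "convex_ereal_on V h \<longleftrightarrow> convex V \<and>
     (\<forall>u\<in>V. \<forall>v\<in>V. \<forall>s\<ge>0. \<forall>t\<ge>0. s + t = 1 \<longrightarrow>
        h (s *\<^sub>R u + t *\<^sub>R v) \<le> ereal s * h u + ereal t * h v)"

definition lsc_on :: "'a::topological_space set \<Rightarrow> ('a \<Rightarrow> ereal) \<Rightarrow> bool" where
  "lsc_on V h \<longleftrightarrow> (\<forall>u\<in>V. h u \<le> Liminf (at u within V) h)"

definition dom_on :: "'a set \<Rightarrow> ('a \<Rightarrow> ereal) \<Rightarrow> 'a set" where
  "dom_on V h = {u \<in> V. h u < \<infinity>}"

definition prox :: "'a::real_normed_vector set \<Rightarrow> ('a \<Rightarrow> ereal) \<Rightarrow> 'a \<Rightarrow> 'a" where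
  "prox V h v = (ARG_MIN (\<lambda>u. h u + ereal (1 / 2 * (norm (u - v))\<^sup>2)) u. u \<in> V)"

text \<open>
  The random vector \<open>col(\<xi>\<^sub>1, \<dots>, \<xi>\<^sub>N)\<close> takes values in \<open>(real ^ 'd) ^ 'i\<close>. The cost of agent
  \<open>i\<close> at \<open>x\<close> is the expectation of \<open>f i x (\<xi> \<omega> $ i)\<close> plus \<open>g i (part own i x)\<close>.
\<close>

definition pseudogradient ::
    "'w measure \<Rightarrow> ('n::finite \<Rightarrow> 'i::finite) \<Rightarrow> ('i \<Rightarrow> real ^ 'n \<Rightarrow> real ^ 'd \<Rightarrow> real)
      \<Rightarrow> ('w \<Rightarrow> real ^ 'd ^ 'i) \<Rightarrow> real ^ 'n \<Rightarrow> real ^ 'n" where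
  "pseudogradient M own f \<xi> x =
     (\<Sum>i\<in>UNIV. integral\<^sup>L M (\<lambda>\<omega>. partial_grad own i (\<lambda>z. f i z (\<xi> \<omega> $ i)) x))"

definition F_SA ::
    "('n::finite \<Rightarrow> 'i::finite) \<Rightarrow> ('i \<Rightarrow> real ^ 'n \<Rightarrow> real ^ 'd \<Rightarrow> real)
      \<Rightarrow> real ^ 'n \<Rightarrow> real ^ 'd ^ 'i \<Rightarrow> real ^ 'n" where
  "F_SA own f x s = (\<Sum>i\<in>UNIV. partial_grad own i (\<lambda>z. f i z (s $ i)) x)"

text \<open>The elements of \<open>SOL\<close> are the variational stochastic Nash equilibria.\<close>

definition SOL ::
    "('n::finite \<Rightarrow> 'i::finite) \<Rightarrow> ('i \<Rightarrow> (real ^ 'n) set) \<Rightarrow> (real ^ 'n \<Rightarrow> real ^ 'n)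
      \<Rightarrow> ('i \<Rightarrow> real ^ 'n \<Rightarrow> ereal) \<Rightarrow> (real ^ 'n) set" where
  "SOL own \<Omega> F g = {xs \<in> joint_set own \<Omega>. \<forall>x\<in>joint_set own \<Omega>.
     ereal (F xs \<bullet> (x - xs)) + (\<Sum>i\<in>UNIV. g i (part own i x) - g i (part own i xs)) \<ge> 0}"

definition sa_error ::
    "'w measure \<Rightarrow> ('n::finite \<Rightarrow> 'i::finite) \<Rightarrow> ('i \<Rightarrow> real ^ 'n \<Rightarrow> real ^ 'd \<Rightarrow> real)
      \<Rightarrow> ('w \<Rightarrow> real ^ 'd ^ 'i) \<Rightarrow> (nat \<Rightarrow> 'w \<Rightarrow> real ^ 'd ^ 'i) \<Rightarrow> (nat \<Rightarrow> 'w \<Rightarrow> real ^ 'n)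
      \<Rightarrow> nat \<Rightarrow> 'w \<Rightarrow> real ^ 'n" where
  "sa_error M own f \<xi> \<xi>s x k \<omega> =
     F_SA own f (x k \<omega>) (\<xi>s k \<omega>) - pseudogradient M own f \<xi> (x k \<omega>)"

text \<open>The sigma-algebra generated by the initial point and the samples before time \<open>k\<close>.\<close>

definition history ::
    "'w measure \<Rightarrow> ('w \<Rightarrow> real ^ 'n) \<Rightarrow> (nat \<Rightarrow> 'w \<Rightarrow> real ^ 'd ^ 'i) \<Rightarrow> nat \<Rightarrow> 'w measure" where
  "history M x0 \<xi>s k = sigma (space M)
     ({x0 -` A \<inter> space M | A. A \<in> sets borel} \<union>
      {\<xi>s j -` B \<inter> space M | j B. j < k \<and> B \<in> sets borel})"

end

theory Submission
  imports Defs
begin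

text \<open>
  The variational inequalities of the proximal step and of \<open>xstar\<close>, together with (iii) and (iv), make
  \<open>V k = \<parallel>x k - xstar\<parallel>\<^sup>2\<close> satisfy
  \<open>V (Suc k) \<le> (1 - 2 \<mu> \<gamma> k) V k + O((\<gamma> k)\<^sup>2) + 2 (\<gamma> k)\<^sup>2 \<parallel>\<epsilon> k\<parallel>\<^sup>2 - 2 \<gamma> k (\<epsilon> k \<bullet> (x k - xstar))\<close>.
  Stop the process when the accumulated conditional second moment of the noise exceeds a level \<open>m\<close>.
  The expectation of the stopped \<open>V\<close> then becomes arbitrarily small at arbitrarily late times,
  because \<open>\<gamma>\<close> is not summable, and a maximal inequality started at such a time bounds the
  probability that \<open>V\<close> is ever large afterwards. Hence \<open>x k\<close> tends to \<open>xstar\<close> almost surely, with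
  no need for a martingale convergence theorem.
\<close>

subsection \<open>Proximal steps\<close>

text \<open>If no point were minimal, each \<open>u\<close> would have some \<open>w u\<close> of
  strictly smaller value, and \<open>r\<close> would stay above \<open>r (w u)\<close> near
  \<open>u\<close>. In a finite subcover take the least of the values \<open>r (w u)\<close>,
  attained at \<open>u0\<close>: the point \<open>w u0\<close> lies in some \<open>T u\<close>,
  which forces \<open>r (w u)\<close> below that least value.\<close>

lemma lsc_attains_inf:
  fixes r :: "'a::topological_space \<Rightarrow> 'b::linorder"
  assumes S: "compact S" "S \<noteq> {}"
    and lsc: "\<And>u c. u \<in> S \<Longrightarrow> c < r u \<Longrightarrow> eventually (\<lambda>z. c < r z) (at u within S)"
  obtains p where "p \<in> S" "\<And>u. u \<in> S \<Longrightarrow> r p \<le> r u"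
proof (rule ccontr)
  assume "\<not> thesis"
  with that have "\<forall>u\<in>S. \<exists>w\<in>S. r w < r u"
    by (meson not_le)
  then obtain w where w: "\<And>u. u \<in> S \<Longrightarrow> w u \<in> S \<and> r (w u) < r u"
    by metis
  \<comment> \<open>The filter \<open>at u within S\<close> is punctured; at \<open>u\<close> itself
    the bound comes from the choice of \<open>w u\<close>.\<close>
  have "\<exists>T. open T \<and> u \<in> T \<and> (\<forall>z\<in>T \<inter> S. r (w u) < r z)" if "u \<in> S" for u
    using lsc[OF that] w[OF that] unfolding eventually_at_topological by (metis IntE)
  then obtain T where T: "\<And>u. u \<in> S \<Longrightarrow> open (T u)" "\<And>u. u \<in> S \<Longrightarrow> u \<in> T u"
      "\<And>u z. u \<in> S \<Longrightarrow> z \<in> T u \<Longrightarrow> z \<in> S \<Longrightarrow> r (w u) < r z"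
    by (metis IntI)
  obtain C where C: "C \<subseteq> S" "finite C" "S \<subseteq> (\<Union>u\<in>C. T u)"
    using compactE_image[OF S(1), of S T] T by blast
  with S have "C \<noteq> {}" by auto
  with C obtain u0 where u0: "u0 \<in> C" "\<And>u. u \<in> C \<Longrightarrow> r (w u0) \<le> r (w u)"
    using ex_min_if_finite[of "(\<lambda>u. r (w u)) ` C"] by (auto simp: not_less)
  with C w have "w u0 \<in> S" by auto
  then obtain u where "u \<in> C" "w u0 \<in> T u" using C by auto
  with T(3)[of u "w u0"] C u0 \<open>w u0 \<in> S\<close> show False
    by (metis not_le subsetD)
qed

text \<open>\<open>prox\<close> is an \<open>ARG_MIN\<close>, hence a Hilbert choice, and carries
  information only once a minimizer is known to exist. The objective is infinite on \<open>V\<close>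
  outside \<open>S\<close>, so it is enough to minimize its real-valued version \<open>hr\<close>
  over the compact set \<open>S\<close>.\<close>

lemma prox_attained:
  fixes g :: "'a::euclidean_space \<Rightarrow> ereal" and v :: 'a
  assumes dom: "dom_on V g = S" and S: "compact S" "S \<noteq> {}"
    and lsc: "lsc_on V g" and fin: "\<And>u. u \<in> V \<Longrightarrow> g u \<noteq> -\<infinity>" and t: "t > 0"
  defines "p \<equiv> prox V (\<lambda>u. ereal t * g u) v"
  shows "p \<in> S"
    and "u \<in> S \<Longrightarrow> t * real_of_ereal (g p) + 1/2 * (norm (p - v))\<^sup>2
           \<le> t * real_of_ereal (g u) + 1/2 * (norm (u - v))\<^sup>2"
proof -
  define r where "r u = real_of_ereal (g u)" for u
  define h where "h u = ereal t * g u + ereal (1/2 * (norm (u - v))\<^sup>2)" for u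
  define hr where "hr u = t * r u + 1/2 * (norm (u - v))\<^sup>2" for u
  have SV: "S \<subseteq> V" using dom by (auto simp: dom_on_def)
  have g_r: "g u = ereal (r u)" if "u \<in> S" for u
    using that fin dom by (cases "g u") (auto simp: r_def dom_on_def)
  have h_hr: "h u = ereal (hr u)" if "u \<in> S" for u
    using g_r[OF that] by (simp add: h_def hr_def)
  have h_inf: "h u = \<infinity>" if "u \<in> V" "u \<notin> S" for u
    using that dom t by (auto simp: h_def dom_on_def)
  have "eventually (\<lambda>z. c < hr z) (at u within S)" if u: "u \<in> S" and c: "c < hr u" for u c
  proof -
    \<comment> \<open>Half of the gap: near \<open>u\<close> the term \<open>t * r\<close> and the
      quadratic term may each drop by less than \<open>e\<close>. For the first this means a
      tolerance of \<open>e / t\<close> on \<open>g\<close>.\<close>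
    define e where "e = (hr u - c) / 2"
    have e: "e > 0" using c by (simp add: e_def)
    have "ereal (r u - e / t) < g u"
      using g_r[OF u] e t by simp
    with lsc u SV have "eventually (\<lambda>z. ereal (r u - e / t) < g z) (at u within V)"
      by (auto simp: lsc_on_def le_Liminf_iff)
    then have "eventually (\<lambda>z. ereal (r u - e / t) < g z) (at u within S)"
      using SV at_le filter_leD by blast
    moreover have "((\<lambda>z. 1/2 * (norm (z - v))\<^sup>2) \<longlongrightarrow> 1/2 * (norm (u - v))\<^sup>2) (at u within S)"
      by (intro tendsto_intros)
    then have "eventually (\<lambda>z. 1/2 * (norm (u - v))\<^sup>2 - e < 1/2 * (norm (z - v))\<^sup>2) (at u within S)"
      by (rule order_tendstoD) (use e in simp)
    moreover have "eventually (\<lambda>z. z \<in> S) (at u within S)"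
      by (simp add: eventually_at_filter)
    ultimately show ?thesis
    proof eventually_elim
      case (elim z)
      then have "r u - e / t < r z" using g_r by simp
      then have "t * r u - e < t * r z"
        using t by (simp add: field_simps)
      with elim(2) show ?case by (simp add: hr_def e_def field_simps)
    qed
  qed
  then obtain q where q: "q \<in> S" "\<And>u. u \<in> S \<Longrightarrow> hr q \<le> hr u"
    using lsc_attains_inf[OF S, of hr] by blast
  have "h q \<le> h u" if "u \<in> V" for u
    using q h_hr h_inf that by (cases "u \<in> S") auto
  then have "is_arg_min h (\<lambda>u. u \<in> V) q"
    using q SV by (auto simp: is_arg_min_def not_less)
  then have "is_arg_min h (\<lambda>u. u \<in> V) p"
    unfolding p_def prox_def arg_min_def h_def by (rule someI)
  then have p: "p \<in> V" "\<And>u. u \<in> V \<Longrightarrow> h p \<le> h u"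
    by (auto simp: is_arg_min_def not_less)
  have "h p \<le> ereal (hr q)" using p(2)[of q] q SV h_hr by auto
  then show pS: "p \<in> S" using h_inf[OF p(1)] by (cases "p \<in> S") auto
  show "u \<in> S \<Longrightarrow> t * real_of_ereal (g p) + 1/2 * (norm (p - v))\<^sup>2
           \<le> t * real_of_ereal (g u) + 1/2 * (norm (u - v))\<^sup>2"
    using p(2)[of u] h_hr[of u] h_hr[OF pS] SV by (auto simp: hr_def r_def)
qed

text \<open>Moving from \<open>p\<close> towards \<open>u\<close> by a fraction \<open>s\<close>
  cannot lower the objective. Convexity bounds the change of \<open>g\<close> linearly in
  \<open>s\<close>, and the square adds a linear term and one of order \<open>s^2\<close>. Dividing
  by \<open>s\<close> and letting \<open>s\<close> tend to 0 leaves the first-order condition, with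
  no subgradient involved.\<close>

lemma prox_variational_inequality:
  fixes g :: "'a::euclidean_space \<Rightarrow> ereal" and v :: 'a
  assumes dom: "dom_on V g = S" and S: "compact S" "S \<noteq> {}" "convex S"
    and lsc: "lsc_on V g" and conv: "convex_ereal_on V g"
    and fin: "\<And>u. u \<in> V \<Longrightarrow> g u \<noteq> -\<infinity>" and t: "t > 0" and u: "u \<in> S"
  defines "p \<equiv> prox V (\<lambda>u. ereal t * g u) v"
  shows "0 \<le> t * (real_of_ereal (g u) - real_of_ereal (g p)) + (p - v) \<bullet> (u - p)"
proof -
  define r where "r u = real_of_ereal (g u)" for u
  have SV: "S \<subseteq> V" using dom by (auto simp: dom_on_def)
  have g_r: "g u = ereal (r u)" if "u \<in> S" for u
    using that fin dom by (cases "g u") (auto simp: r_def dom_on_def)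
  have p: "p \<in> S" and opt: "\<And>z. z \<in> S \<Longrightarrow> t * r p + 1/2 * (norm (p - v))\<^sup>2
      \<le> t * r z + 1/2 * (norm (z - v))\<^sup>2"
    unfolding p_def r_def using prox_attained[OF dom S(1,2) lsc fin t] by auto
  define K where "K = t * (r u - r p) + (p - v) \<bullet> (u - p)"
  have bound: "- K \<le> s / 2 * (norm (u - p))\<^sup>2" if s: "0 < s" "s \<le> 1" for s
  proof -
    define z where "z = (1 - s) *\<^sub>R p + s *\<^sub>R u"
    have z: "z \<in> S" using S(3) p u s by (auto simp: z_def convex_alt)
    have "g z \<le> ereal (1 - s) * g p + ereal s * g u"
      using conv p u SV s unfolding convex_ereal_on_def z_def by (auto simp: subset_eq)
    then have "r z \<le> (1 - s) * r p + s * r u"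
      using g_r z p u by simp
    then have "t * r z \<le> t * ((1 - s) * r p + s * r u)"
      using t by simp
    \<comment> \<open>Minimality of \<open>p\<close> against \<open>z\<close> combined with
      convexity: \<open>a\<close> and \<open>c\<close> stand for \<open>t * r p\<close> and
      \<open>t * r z\<close>, \<open>b\<close> and \<open>d\<close> for the squared distances of
      \<open>p\<close> and \<open>z\<close> to \<open>v\<close>, and \<open>e'\<close> for the
      convex bound on \<open>c\<close>.\<close>
    moreover have "0 \<le> e' - a + 1/2 * (d - b)"
      if "a + 1/2 * b \<le> c + 1/2 * d" "c \<le> e'" for a b c d e' :: real
      using that by (simp add: field_simps)
    ultimately have "0 \<le> t * ((1 - s) * r p + s * r u) - t * r p
        + 1/2 * ((norm (z - v))\<^sup>2 - (norm (p - v))\<^sup>2)"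
      using opt[OF z] by blast
    also have "z - v = (p - v) + s *\<^sub>R (u - p)"
      by (simp add: z_def algebra_simps)
    also have "(norm ((p - v) + s *\<^sub>R (u - p)))\<^sup>2 - (norm (p - v))\<^sup>2
        = 2 * s * ((p - v) \<bullet> (u - p)) + s\<^sup>2 * (norm (u - p))\<^sup>2"
      unfolding power2_norm_eq_inner
      by (simp add: inner_add_left inner_add_right inner_commute power2_eq_square)
    finally have "0 \<le> s * (K + s / 2 * (norm (u - p))\<^sup>2)"
      by (simp add: K_def algebra_simps power2_eq_square)
    with s show ?thesis by (simp add: zero_le_mult_iff)
  qed
  have "((\<lambda>s. s / 2 * (norm (u - p))\<^sup>2) \<longlongrightarrow> 0 / 2 * (norm (u - p))\<^sup>2) (at_right 0)"
    by (intro tendsto_intros) auto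
  moreover have "eventually (\<lambda>s. - K \<le> s / 2 * (norm (u - p))\<^sup>2) (at_right 0)"
    unfolding eventually_at_right_field by (intro exI[of _ 1] conjI allI impI bound) auto
  ultimately have "- K \<le> 0 / 2 * (norm (u - p))\<^sup>2"
    by (rule tendsto_lowerbound) simp
  then show ?thesis by (simp add: K_def r_def)
qed

section \<open>Coordinate blocks and the forward-backward step compared with a solution\<close>

lemma part_diff: "part own i (x - y) = part own i x - part own i y"
  by (simp add: part_def vec_eq_iff)

lemma part_scaleR: "part own i (a *\<^sub>R x) = a *\<^sub>R part own i x"
  by (simp add: part_def vec_eq_iff)

lemma sum_part:
  fixes own :: "'n::finite \<Rightarrow> 'i::finite"
  shows "(\<Sum>i\<in>UNIV. part own i x) = x"
  by (simp add: part_def vec_eq_iff)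

text \<open>Distinct blocks are orthogonal. This lets the proximal inequalities of the single agents
  add up to one inequality in the joint space.\<close>

lemma sum_inner_part:
  fixes own :: "'n::finite \<Rightarrow> 'i::finite"
  shows "(\<Sum>i\<in>UNIV. part own i x \<bullet> part own i y) = x \<bullet> y"
proof -
  have "part own i x \<bullet> part own i y = part own i x \<bullet> y" for i
    unfolding inner_vec_def by (rule sum.cong) (auto simp: part_def)
  then have "(\<Sum>i\<in>UNIV. part own i x \<bullet> part own i y) = (\<Sum>i\<in>UNIV. part own i x) \<bullet> y"
    by (simp add: inner_sum_left)
  then show ?thesis by (simp add: sum_part)
qed

lemma bounded_joint_set:
  fixes own :: "'n::finite \<Rightarrow> 'i::finite"
  assumes "\<And>i. bounded (\<Omega> i)"
  shows "bounded (joint_set own \<Omega>)"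
proof -
  from assms obtain R where R: "\<And>i z. z \<in> \<Omega> i \<Longrightarrow> norm z \<le> R i"
    unfolding bounded_iff by metis
  have "norm z \<le> (\<Sum>i\<in>UNIV. R i)" if "z \<in> joint_set own \<Omega>" for z
  proof -
    have "norm z = norm (\<Sum>i\<in>UNIV. part own i z)" by (simp add: sum_part)
    also have "\<dots> \<le> (\<Sum>i\<in>UNIV. norm (part own i z))" by (rule norm_sum)
    also have "\<dots> \<le> (\<Sum>i\<in>UNIV. R i)"
      using that R by (auto intro!: sum_mono simp: joint_set_def)
    finally show ?thesis .
  qed
  then show ?thesis by (auto simp: bounded_iff)
qed

text \<open>Testing the optimality condition of \<open>p\<close> with \<open>z\<close> and the one of \<open>z\<close> with \<open>p\<close> gives
  \<open>\<parallel>p - z\<parallel>\<^sup>2 \<le> (p - z) \<bullet> (x - z - t *\<^sub>R (w - F z))\<close>.\<close>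

lemma forward_backward_step:
  fixes own :: "'n::finite \<Rightarrow> 'i::finite"
  assumes g: "\<And>i u. u \<in> block own i \<Longrightarrow> g i u \<noteq> -\<infinity>" "\<And>i. lsc_on (block own i) (g i)"
      "\<And>i. convex_ereal_on (block own i) (g i)" "\<And>i. dom_on (block own i) (g i) = \<Omega> i"
    and \<Omega>: "\<And>i. \<Omega> i \<noteq> {}" "\<And>i. compact (\<Omega> i)" "\<And>i. convex (\<Omega> i)"
    and t: "t > 0"
    and p: "\<And>i. part own i p =
      prox (block own i) (\<lambda>u. ereal t * g i u) (part own i x - t *\<^sub>R part own i w)"
    and z: "z \<in> SOL own \<Omega> F g"
  shows "p \<in> joint_set own \<Omega>" and "norm (p - z) \<le> norm (x - z - t *\<^sub>R (w - F z))"
proof -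
  define r where "r i u = real_of_ereal (g i u)" for i u
  have g_r: "g i u = ereal (r i u)" if "u \<in> \<Omega> i" for i u
    using that g(1)[of u i] g(4)[of i] by (cases "g i u") (auto simp: r_def dom_on_def)
  have pO: "part own i p \<in> \<Omega> i" for i
    unfolding p by (rule prox_attained[OF g(4) \<Omega>(2,1) g(2) g(1) t])
  then show pJ: "p \<in> joint_set own \<Omega>" by (simp add: joint_set_def)
  have zO: "part own i z \<in> \<Omega> i" for i
    using z by (simp add: SOL_def joint_set_def)
  have vi: "0 \<le> t * (r i (part own i z) - r i (part own i p))
      + part own i (p - (x - t *\<^sub>R w)) \<bullet> part own i (z - p)" for i
    using prox_variational_inequality[OF g(4) \<Omega>(2,1,3) g(2,3) g(1) t zO,
        of i "part own i x - t *\<^sub>R part own i w"]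
    by (simp add: p[symmetric] r_def part_diff part_scaleR)
  have "0 \<le> (\<Sum>i\<in>UNIV. t * (r i (part own i z) - r i (part own i p))
      + part own i (p - (x - t *\<^sub>R w)) \<bullet> part own i (z - p))"
    by (intro sum_nonneg vi)
  then have "0 \<le> t * (\<Sum>i\<in>UNIV. r i (part own i z) - r i (part own i p))
      + (p - (x - t *\<^sub>R w)) \<bullet> (z - p)"
    by (simp only: sum.distrib sum_distrib_left[symmetric] sum_inner_part)
  moreover have "0 \<le> F z \<bullet> (p - z) + (\<Sum>i\<in>UNIV. r i (part own i p) - r i (part own i z))"
  proof -
    have "0 \<le> ereal (F z \<bullet> (p - z)) + (\<Sum>i\<in>UNIV. g i (part own i p) - g i (part own i z))"
      using z pJ by (simp add: SOL_def)
    also have "\<dots> = ereal (F z \<bullet> (p - z) + (\<Sum>i\<in>UNIV. r i (part own i p) - r i (part own i z)))"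
      by (simp add: g_r pO zO)
    finally show ?thesis by simp
  qed
  \<comment> \<open>After scaling by \<open>t\<close>, the differences of the \<open>r i\<close> are
    the negatives of those in the summed proximal inequality and cancel when the two are
    added.\<close>
  then have "0 \<le> t * (F z \<bullet> (p - z)) + t * (\<Sum>i\<in>UNIV. r i (part own i p) - r i (part own i z))"
    using t by (simp flip: distrib_left)
  ultimately have "0 \<le> t * (F z \<bullet> (p - z)) + (p - (x - t *\<^sub>R w)) \<bullet> (z - p)"
    by (simp add: sum_subtractf algebra_simps)
  also have "\<dots> = (p - z) \<bullet> (x - z - t *\<^sub>R (w - F z)) - (norm (p - z))\<^sup>2"
    unfolding power2_norm_eq_inner
    by (simp add: inner_diff_left inner_diff_right inner_commute algebra_simps)
  finally have "norm (p - z) * norm (p - z) \<le> norm (p - z) * norm (x - z - t *\<^sub>R (w - F z))"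
    using norm_cauchy_schwarz[of "p - z" "x - z - t *\<^sub>R (w - F z)"] by (simp add: power2_eq_square)
  then show "norm (p - z) \<le> norm (x - z - t *\<^sub>R (w - F z))"
    by (cases "p = z") auto
qed

subsection \<open>Almost supermartingales\<close>

text \<open>If \<open>a\<close> stayed at or above \<open>d\<close> from \<open>N\<close> on, every
  step would lose at least \<open>d * c k\<close>, while all gains together are at most
  \<open>suminf b\<close>. As \<open>a\<close> is nonnegative, the partial sums of \<open>c\<close>
  would be bounded.\<close>

lemma descent_small_infinitely_often:
  fixes a b c :: "nat \<Rightarrow> real"
  assumes a: "\<And>k. 0 \<le> a k" and b: "\<And>k. 0 \<le> b k" "summable b"
    and c: "filterlim (\<lambda>n. \<Sum>k<n. c k) at_top sequentially" "\<And>k. 0 \<le> c k"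
    and step: "\<And>k. a (Suc k) \<le> a k - c k * a k + b k"
    and d: "0 < d"
  obtains n where "n \<ge> N" "a n < d"
proof (rule ccontr)
  assume "\<not> thesis"
  with that have ge: "d \<le> a n" if "n \<ge> N" for n
    using that not_le by blast
  have sum_le: "a (N + k) + d * (\<Sum>j=N..<N+k. c j) \<le> a N + (\<Sum>j=N..<N+k. b j)" for k
  proof (induction k)
    case (Suc k)
    have "c (N + k) * d \<le> c (N + k) * a (N + k)"
      using c(2) ge by (intro mult_left_mono) auto
    with Suc step[of "N + k"] show ?case by (simp add: algebra_simps)
  qed simp
  have bound: "(\<Sum>j<N+k. c j) \<le> (\<Sum>j<N. c j) + (a N + suminf b) / d" for k
  proof -
    have "(\<Sum>j=N..<N+k. b j) \<le> suminf b"
      by (intro sum_le_suminf b) auto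
    with sum_le[of k] a[of "N + k"] have "d * (\<Sum>j=N..<N+k. c j) \<le> a N + suminf b"
      by linarith
    then have "(\<Sum>j=N..<N+k. c j) \<le> (a N + suminf b) / d"
      using d by (simp add: pos_le_divide_eq mult.commute)
    moreover have "(\<Sum>j<N+k. c j) = (\<Sum>j<N. c j) + (\<Sum>j=N..<N+k. c j)"
      by (metis atLeast0LessThan le_add1 sum.atLeastLessThan_concat zero_le)
    ultimately show ?thesis by linarith
  qed
  have "eventually (\<lambda>n. (\<Sum>j<N. c j) + (a N + suminf b) / d + 1 \<le> (\<Sum>j<n. c j)) sequentially"
    using c(1) by (simp add: filterlim_at_top)
  then obtain n0 where "\<And>n. n \<ge> n0 \<Longrightarrow> (\<Sum>j<N. c j) + (a N + suminf b) / d + 1 \<le> (\<Sum>j<n. c j)"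
    by (auto simp: eventually_sequentially)
  then have "(\<Sum>j<N. c j) + (a N + suminf b) / d + 1 \<le> (\<Sum>j<N+n0. c j)" by simp
  with bound[of n0] show False by linarith
qed

context prob_space
begin

lemma integrable_indicator_times:
  fixes f :: "'a \<Rightarrow> real"
  assumes "B \<in> events" "integrable M f"
  shows "integrable M (\<lambda>\<omega>. indicator B \<omega> * f \<omega>)"
  using integrable_mult_indicator[OF assms] by simp

text \<open>A maximal inequality for processes whose integral over any past event grows by at most
  \<open>b k\<close>. With \<open>E k\<close> the event that level \<open>l\<close> has been reached
  and \<open>B k\<close> its complement, the sum of \<open>l * prob (E k)\<close> and the integral
  of \<open>W (n + k)\<close> over \<open>B k\<close> grows by at most \<open>b (n + k)\<close> per
  step.\<close>

lemma Ville_inequality: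
  fixes W :: "nat \<Rightarrow> 'a \<Rightarrow> real"
  assumes sub: "\<And>k. subalgebra M (Fil k)" and mono: "\<And>j k. j \<le> k \<Longrightarrow> subalgebra (Fil k) (Fil j)"
    and W: "\<And>k. W k \<in> borel_measurable (Fil k)" "\<And>k. integrable M (W k)"
      "\<And>k \<omega>. \<omega> \<in> space M \<Longrightarrow> 0 \<le> W k \<omega>"
    and step: "\<And>k B. B \<in> sets (Fil k) \<Longrightarrow>
      (\<integral>\<omega>. indicator B \<omega> * W (Suc k) \<omega> \<partial>M) \<le> (\<integral>\<omega>. indicator B \<omega> * W k \<omega> \<partial>M) + b k"
    and l: "0 < l"
  shows "l * prob {\<omega>\<in>space M. \<exists>j\<in>{n..n+k}. l \<le> W j \<omega>} \<le> expectation (W n) + (\<Sum>j=n..<n+k. b j)"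
proof -
  have [measurable]: "W j \<in> borel_measurable (Fil k)" if "j \<le> k" for j k
    using measurable_from_subalg[OF mono[OF that] W(1)] .
  have [measurable]: "W j \<in> borel_measurable M" for j
    using measurable_from_subalg[OF sub W(1)] .
  have sp: "space (Fil k) = space M" for k
    using sub[of k] by (simp add: subalgebra_def)
  define E where "E k = {\<omega>\<in>space M. \<exists>j\<in>{n..n+k}. l \<le> W j \<omega>}" for k
  define B where "B k = {\<omega>\<in>space M. \<forall>j\<in>{n..n+k}. W j \<omega> < l}" for k
  have [measurable]: "E k \<in> events" for k unfolding E_def by measurable
  have B_Fil: "B k \<in> sets (Fil (n + k))" for k
    unfolding B_def sp[of "n + k", symmetric] by measurable auto
  have [measurable]: "B k \<in> events" for k
    using B_Fil sub by (auto simp: subalgebra_def)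
  have int: "integrable M (\<lambda>\<omega>. indicator (B k) \<omega> * W j \<omega>)" for k j
    by (intro integrable_indicator_times W) auto
  have intE: "integrable M (\<lambda>\<omega>. l * indicator (E k) \<omega>)" for k
    by (intro integrable_mult_right) (auto simp: emeasure_eq_measure)
  have E_int: "(\<integral>\<omega>. l * indicator (E k) \<omega> \<partial>M) = l * prob (E k)" for k
    by (simp add: E_def)
  have split: "indicator (B k) \<omega> = 1 - (indicator (E k) \<omega> :: real)" if "\<omega> \<in> space M" for k \<omega>
  proof -
    have "\<omega> \<in> B k \<longleftrightarrow> \<omega> \<notin> E k"
      using that unfolding E_def B_def by (simp add: not_le)
    then show ?thesis by (simp add: indicator_def)
  qed
  have "l * prob (E k) + (\<integral>\<omega>. indicator (B k) \<omega> * W (n + k) \<omega> \<partial>M)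
      \<le> expectation (W n) + (\<Sum>j=n..<n+k. b j)"
  proof (induction k)
    case 0
    have "(\<integral>\<omega>. l * indicator (E 0) \<omega> + indicator (B 0) \<omega> * W (n + 0) \<omega> \<partial>M) \<le> expectation (W n)"
    proof (intro integral_mono Bochner_Integration.integrable_add int intE W)
      fix \<omega> assume w: "\<omega> \<in> space M"
      have "indicator (E 0) \<omega> = (if l \<le> W n \<omega> then 1 else 0 :: real)"
        using w by (simp add: E_def indicator_def)
      then show "l * indicator (E 0) \<omega> + indicator (B 0) \<omega> * W (n + 0) \<omega> \<le> W n \<omega>"
        by (simp add: split[OF w])
    qed
    then show ?case
      by (simp add: Bochner_Integration.integral_add[OF intE int] E_int)
  next
    case (Suc k)
    \<comment> \<open>A path of \<open>B k\<close> with \<open>W (n + Suc k)\<close> at least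
      \<open>l\<close> moves into \<open>E (Suc k)\<close>, and its value there pays for the
      \<open>l\<close> that it now contributes.\<close>
    have "(\<integral>\<omega>. l * indicator (E (Suc k)) \<omega> + indicator (B (Suc k)) \<omega> * W (n + Suc k) \<omega> \<partial>M)
        \<le> (\<integral>\<omega>. l * indicator (E k) \<omega> + indicator (B k) \<omega> * W (n + Suc k) \<omega> \<partial>M)"
    proof (intro integral_mono Bochner_Integration.integrable_add int intE)
      fix \<omega> assume w: "\<omega> \<in> space M"
      show "l * indicator (E (Suc k)) \<omega> + indicator (B (Suc k)) \<omega> * W (n + Suc k) \<omega>
          \<le> l * indicator (E k) \<omega> + indicator (B k) \<omega> * W (n + Suc k) \<omega>"
      proof -
        have "indicator (E (Suc k)) \<omega> =
            (if l \<le> W (n + Suc k) \<omega> then 1 else indicator (E k) \<omega> :: real)"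
          using w by (simp add: E_def indicator_def atLeastAtMostSuc_conv)
        moreover have "indicator (E k) \<omega> \<in> {0, 1 :: real}"
          by (simp add: indicator_def)
        ultimately show ?thesis
          using W(3)[OF w, of "n + Suc k"] l by (auto simp: split[OF w])
      qed
    qed
    \<comment> \<open>\<open>B k\<close> is decided by time \<open>n + k\<close>, so it is an
      admissible event in \<open>step\<close>.\<close>
    also have "\<dots> \<le> l * prob (E k) + (\<integral>\<omega>. indicator (B k) \<omega> * W (n + k) \<omega> \<partial>M) + b (n + k)"
      using step[OF B_Fil, of k] by (simp add: Bochner_Integration.integral_add[OF intE int] E_int)
    also have "\<dots> \<le> expectation (W n) + (\<Sum>j=n..<n+Suc k. b j)"
      using Suc by simp
    finally show ?case
      by (simp add: Bochner_Integration.integral_add[OF intE int] E_int)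
  qed
  moreover have "0 \<le> (\<integral>\<omega>. indicator (B k) \<omega> * W (n + k) \<omega> \<partial>M)"
    using W(3) by (intro integral_nonneg_AE AE_I2) auto
  ultimately show ?thesis by (simp add: E_def)
qed

text \<open>The means obey a descent recursion, so they are small at arbitrarily late times
  \<open>n\<close>. Choosing \<open>n\<close> so late that the remaining \<open>b\<close> are small
  too, the maximal inequality makes it unlikely that \<open>W\<close> reaches a given level after
  \<open>n\<close>.\<close>

lemma almost_supermartingale_tendsto_0:
  fixes W :: "nat \<Rightarrow> 'a \<Rightarrow> real"
  assumes sub: "\<And>k. subalgebra M (Fil k)" and mono: "\<And>j k. j \<le> k \<Longrightarrow> subalgebra (Fil k) (Fil j)"
    and W: "\<And>k. W k \<in> borel_measurable (Fil k)" "\<And>k. integrable M (W k)"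
      "\<And>k \<omega>. \<omega> \<in> space M \<Longrightarrow> 0 \<le> W k \<omega>"
    and b: "\<And>k. 0 \<le> b k" "summable b"
    and c: "filterlim (\<lambda>n. \<Sum>k<n. c k) at_top sequentially" "\<And>k. 0 \<le> c k"
    and step: "\<And>k B. B \<in> sets (Fil k) \<Longrightarrow>
      (\<integral>\<omega>. indicator B \<omega> * W (Suc k) \<omega> \<partial>M)
        \<le> (1 - c k) * (\<integral>\<omega>. indicator B \<omega> * W k \<omega> \<partial>M) + b k"
  shows "AE \<omega> in M. (\<lambda>k. W k \<omega>) \<longlonglongrightarrow> 0"
proof -
  have [measurable]: "W j \<in> borel_measurable M" for j
    using measurable_from_subalg[OF sub W(1)] .
  \<comment> \<open>The contraction term is nonnegative and is dropped, which gives the form that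
    the maximal inequality takes; the full recursion serves only for the means.\<close>
  have step': "(\<integral>\<omega>. indicator B \<omega> * W (Suc k) \<omega> \<partial>M) \<le> (\<integral>\<omega>. indicator B \<omega> * W k \<omega> \<partial>M) + b k"
    if "B \<in> sets (Fil k)" for k B
  proof -
    have "0 \<le> c k * (\<integral>\<omega>. indicator B \<omega> * W k \<omega> \<partial>M)"
      using W(3) c(2) by (intro mult_nonneg_nonneg integral_nonneg_AE AE_I2) auto
    with step[OF that] show ?thesis by (simp add: algebra_simps)
  qed
  have mean_step: "expectation (W (Suc k)) \<le> expectation (W k) - c k * expectation (W k) + b k" for k
  proof -
    have top: "space M \<in> sets (Fil k)"
      using sub[of k] by (metis sets.top subalgebra_def)
    have eq: "(\<integral>\<omega>. indicator (space M) \<omega> * W j \<omega> \<partial>M) = expectation (W j)" for j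
      by (rule Bochner_Integration.integral_cong) auto
    show ?thesis using step[OF top, unfolded eq] by (simp add: algebra_simps)
  qed
  have tail: "\<exists>n. prob {\<omega>\<in>space M. \<exists>j\<ge>n. l \<le> W j \<omega>} \<le> d" if l: "0 < l" and d: "0 < d" for l d
  proof -
    \<comment> \<open>The budget \<open>l * d\<close> is split evenly between the mean at time
      \<open>n\<close> and the tail of \<open>b\<close>.\<close>
    have "0 < d * l / 2" using l d by simp
    with b(2) obtain N where N: "\<And>n k. n \<ge> N \<Longrightarrow> norm (sum b {n..<k}) < d * l / 2"
      unfolding summable_Cauchy by blast
    have "0 \<le> expectation (W k)" for k
      using W(3) by (intro integral_nonneg_AE AE_I2) auto
    from descent_small_infinitely_often[OF this b c mean_step \<open>0 < d * l / 2\<close>]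
    obtain n where n: "n \<ge> N" "expectation (W n) < d * l / 2" .
    define E where "E k = {\<omega>\<in>space M. \<exists>j\<in>{n..n+k}. l \<le> W j \<omega>}" for k
    have "prob (E k) \<le> d" for k
    proof -
      have "l * prob (E k) \<le> expectation (W n) + sum b {n..<n+k}"
        unfolding E_def by (rule Ville_inequality[where Fil=Fil and W=W and b=b, OF sub mono W step' l])
      also have "\<dots> \<le> l * d"
        using N[OF n(1), of "n + k"] n(2) by (simp add: mult.commute abs_less_iff)
      finally show ?thesis using l by simp
    qed
    \<comment> \<open>Continuity from below carries the bound from finite horizons to all times
      after \<open>n\<close>.\<close>
    moreover have "(\<lambda>k. prob (E k)) \<longlonglongrightarrow> prob (\<Union>k. E k)"
    proof (rule finite_Lim_measure_incseq)
      show "range E \<subseteq> events" by (auto simp: E_def)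
      have "{n..n+i} \<subseteq> {n..n+j}" if "i \<le> j" for i j using that by simp
      then show "incseq E" unfolding incseq_def E_def by blast
    qed
    ultimately have "prob (\<Union>k. E k) \<le> d"
      by (intro LIMSEQ_le_const2[where X="\<lambda>k. prob (E k)"]) auto
    moreover have "(\<Union>k. E k) = {\<omega>\<in>space M. \<exists>j\<ge>n. l \<le> W j \<omega>}"
    proof (intro set_eqI iffI)
      fix \<omega> assume "\<omega> \<in> {\<omega>\<in>space M. \<exists>j\<ge>n. l \<le> W j \<omega>}"
      then obtain j where "\<omega> \<in> space M" "n \<le> j" "l \<le> W j \<omega>" by auto
      then have "\<omega> \<in> E (j - n)" by (auto simp: E_def intro!: bexI[of _ j])
      then show "\<omega> \<in> (\<Union>k. E k)" by blast
    qed (auto simp: E_def)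
    ultimately show ?thesis by auto
  qed
  have ev: "AE \<omega> in M. eventually (\<lambda>j. W j \<omega> < l) sequentially" if l: "0 < l" for l
  proof -
    define E where "E = {\<omega>\<in>space M. \<forall>n. \<exists>j\<ge>n. l \<le> W j \<omega>}"
    have [measurable]: "E \<in> events" unfolding E_def by measurable
    have "prob E \<le> d" if d: "0 < d" for d
    proof -
      obtain n where n: "prob {\<omega>\<in>space M. \<exists>j\<ge>n. l \<le> W j \<omega>} \<le> d" using tail[OF l d] ..
      have "prob E \<le> prob {\<omega>\<in>space M. \<exists>j\<ge>n. l \<le> W j \<omega>}"
        by (rule finite_measure_mono) (auto simp: E_def)
      with n show ?thesis by simp
    qed
    then have "prob E = 0"
      using field_le_epsilon[of "prob E" 0] by (simp add: measure_le_0_iff)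
    then have "AE \<omega> in M. \<omega> \<notin> E"
      by (simp add: prob_eq_0)
    then show ?thesis
      using AE_space by eventually_elim (clarsimp simp: E_def eventually_sequentially, metis not_le)
  qed
  \<comment> \<open>Countably many levels suffice, so the exceptional null sets can be
    united.\<close>
  have "AE \<omega> in M. \<forall>m. eventually (\<lambda>j. W j \<omega> < inverse (real (Suc m))) sequentially"
    by (intro AE_all_countable[THEN iffD2] allI ev) simp
  then show ?thesis
    using AE_space
  proof eventually_elim
    case (elim \<omega>)
    show ?case
    proof (rule order_tendstoI)
      show "eventually (\<lambda>k. a < W k \<omega>) sequentially" if "a < 0" for a
        using less_le_trans[OF that W(3)[OF elim(2)]] by (intro always_eventually allI)
      show "eventually (\<lambda>k. W k \<omega> < a) sequentially" if "0 < a" for a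
        using reals_Archimedean[OF that] elim(1) by (meson eventually_mono less_trans)
    qed
  qed
qed

section \<open>Localization by the accumulated conditional noise\<close>

text \<open>The errors are not assumed square integrable; only their weighted conditional second
  moments have an almost surely finite sum. Cutting off when this sum exceeds \<open>m\<close> makes
  the errors square integrable and turns the squared norm of \<open>d k\<close> into an almost
  supermartingale. Almost every path stays below some level \<open>m\<close>.\<close>

lemma stochastic_descent_tendsto_0:
  fixes d e :: "nat \<Rightarrow> 'a \<Rightarrow> 'v::euclidean_space" and \<gamma> a c :: "nat \<Rightarrow> real"
  assumes sub: "\<And>k. subalgebra M (Fil k)" and mono: "\<And>j k. j \<le> k \<Longrightarrow> subalgebra (Fil k) (Fil j)"
    and d: "\<And>k. d k \<in> borel_measurable (Fil k)" "\<And>k \<omega>. \<omega> \<in> space M \<Longrightarrow> norm (d k \<omega>) \<le> D"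
    and e: "\<And>k. e k \<in> borel_measurable M"
      "\<And>k b. b \<in> Basis \<Longrightarrow> AE \<omega> in M. real_cond_exp M (Fil k) (\<lambda>\<omega>. e k \<omega> \<bullet> b) \<omega> = 0"
      "AE \<omega> in M. (\<Sum>k. ennreal ((\<gamma> k)\<^sup>2) *
         nn_cond_exp M (Fil k) (\<lambda>\<omega>. ennreal ((norm (e k \<omega>))\<^sup>2)) \<omega>) < \<infinity>"
    and \<gamma>: "\<And>k. 0 < \<gamma> k"
    and a: "\<And>k. 0 \<le> a k" "summable a"
    and c: "filterlim (\<lambda>n. \<Sum>k<n. c k) at_top sequentially" "\<And>k. 0 \<le> c k"
    and step: "\<And>k \<omega>. \<omega> \<in> space M \<Longrightarrow> (norm (d (Suc k) \<omega>))\<^sup>2 \<le> (1 - c k) * (norm (d k \<omega>))\<^sup>2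
      + a k + 2 * (\<gamma> k)\<^sup>2 * (norm (e k \<omega>))\<^sup>2 - 2 * \<gamma> k * (e k \<omega> \<bullet> d k \<omega>)"
  shows "AE \<omega> in M. (\<lambda>k. d k \<omega>) \<longlonglongrightarrow> 0"
proof -
  have sfs: "sigma_finite_subalgebra M (Fil k)" for k
    by (intro finite_measure_subalgebra_is_sigma_finite finite_measure_subalgebra.intro
        finite_measure_subalgebra_axioms.intro finite_measure_axioms sub)
  have sp: "space (Fil k) = space M" for k
    using sub[of k] by (simp add: subalgebra_def)
  have sub_events: "B \<in> events" if "B \<in> sets (Fil k)" for B k
    using that sub[of k] by (auto simp: subalgebra_def)
  have [measurable]: "d k \<in> borel_measurable M" "e k \<in> borel_measurable M" for k
    using measurable_from_subalg[OF sub d(1)] e(1) .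
  define C where "C k = nn_cond_exp M (Fil k) (\<lambda>\<omega>. ennreal ((norm (e k \<omega>))\<^sup>2))" for k
  have C_Fil: "C j \<in> borel_measurable (Fil k)" if "j \<le> k" for j k
    using measurable_from_subalg[OF mono[OF that] borel_measurable_nn_cond_exp] unfolding C_def .
  have [measurable]: "C k \<in> borel_measurable M" for k
    using measurable_from_subalg[OF sub C_Fil] by blast
  have D0: "0 \<le> D"
    using not_empty d(2) norm_ge_zero order_trans by (metis ex_in_conv)
  have localized: "AE \<omega> in M. (\<forall>k. (\<Sum>j\<le>k. ennreal ((\<gamma> j)\<^sup>2) * C j \<omega>) \<le> of_nat m)
      \<longrightarrow> (\<lambda>k. d k \<omega>) \<longlonglongrightarrow> 0" for m :: nat
  proof -
    define S where "S k \<omega> = (\<Sum>j\<le>k. ennreal ((\<gamma> j)\<^sup>2) * C j \<omega>)" for k \<omega>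
    have S_Fil: "S k \<in> borel_measurable (Fil k)" for k
      unfolding S_def using C_Fil by (intro borel_measurable_sum borel_measurable_times_ennreal) auto
    \<comment> \<open>The sum in \<open>S k\<close> includes index \<open>k\<close>: its last term
      is a conditional expectation given \<open>Fil k\<close>, so \<open>A k\<close> is known at
      time \<open>k\<close> and yet controls the error made in step \<open>k\<close>.\<close>
    define A where "A k = {\<omega>\<in>space M. S k \<omega> \<le> of_nat m}" for k
    have A_Fil: "A k \<in> sets (Fil k)" for k
      unfolding A_def sp[of k, symmetric] using S_Fil[of k] by measurable
    have [measurable]: "A k \<in> events" for k
      using sub_events[OF A_Fil] .
    have A_Suc: "A (Suc k) \<subseteq> A k" for k
      by (auto simp: A_def S_def intro: order_trans[rotated])
    define q where "q k = (\<integral>\<^sup>+\<omega>. indicator (A k) \<omega> * ennreal ((norm (e k \<omega>))\<^sup>2) \<partial>M)" for k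
    have q_C: "q k = (\<integral>\<^sup>+\<omega>. indicator (A k) \<omega> * C k \<omega> \<partial>M)" for k
      unfolding q_def C_def using A_Fil
      by (intro sigma_finite_subalgebra.nn_cond_exp_intg[OF sfs, symmetric]) auto
    \<comment> \<open>While a path is in \<open>A n\<close> the sum is at most \<open>S n\<close>,
      hence at most \<open>m\<close>; outside \<open>A n\<close> the new term vanishes.\<close>
    have partial: "(\<Sum>k<n. ennreal ((\<gamma> k)\<^sup>2) * (indicator (A k) \<omega> * C k \<omega>)) \<le> of_nat m"
      if "\<omega> \<in> space M" for n \<omega>
    proof (induction n)
      case (Suc n)
      show ?case
      proof (cases "\<omega> \<in> A n")
        case True
        have "(\<Sum>k<Suc n. ennreal ((\<gamma> k)\<^sup>2) * (indicator (A k) \<omega> * C k \<omega>)) \<le> S n \<omega>"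
          unfolding S_def lessThan_Suc_atMost
          by (intro sum_mono mult_left_mono) (auto simp: indicator_def)
        also have "S n \<omega> \<le> of_nat m" using True by (simp add: A_def)
        finally show ?thesis .
      next
        case False
        with Suc show ?thesis by simp
      qed
    qed simp
    have sum_q: "(\<Sum>k<n. ennreal ((\<gamma> k)\<^sup>2) * q k) \<le> of_nat m" for n
    proof -
      have "(\<Sum>k<n. ennreal ((\<gamma> k)\<^sup>2) * q k)
          = (\<integral>\<^sup>+\<omega>. (\<Sum>k<n. ennreal ((\<gamma> k)\<^sup>2) * (indicator (A k) \<omega> * C k \<omega>)) \<partial>M)"
        by (simp add: q_C nn_integral_sum nn_integral_cmult)
      also have "\<dots> \<le> (\<integral>\<^sup>+\<omega>. of_nat m \<partial>M)"
        using partial by (intro nn_integral_mono) auto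
      finally show ?thesis by (simp add: emeasure_space_1)
    qed
    \<comment> \<open>Each term of a bounded sum is finite, and its weight is nonzero because
      \<open>\<gamma> k\<close> is positive.\<close>
    have q_fin: "q k < \<infinity>" for k
    proof -
      have "ennreal ((\<gamma> k)\<^sup>2) * q k \<le> (\<Sum>k<Suc k. ennreal ((\<gamma> k)\<^sup>2) * q k)"
        by simp
      also have "\<dots> < \<infinity>"
        using sum_q[of "Suc k"] by (metis ennreal_of_nat_neq_top infinity_ennreal_def le_less_trans less_top of_nat_less_top)
      finally show ?thesis
        using \<gamma>[of k] by (auto simp: ennreal_mult_less_top)
    qed
    have int_e2: "integrable M (\<lambda>\<omega>. indicator (A k) \<omega> * (norm (e k \<omega>))\<^sup>2)" for k
    proof (rule integrableI_nonneg)
      show "(\<integral>\<^sup>+\<omega>. ennreal (indicator (A k) \<omega> * (norm (e k \<omega>))\<^sup>2) \<partial>M) < \<infinity>"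
        using q_fin[of k] by (simp add: q_def ennreal_mult' ennreal_indicator)
    qed auto
    define v where "v k = (\<integral>\<omega>. indicator (A k) \<omega> * (norm (e k \<omega>))\<^sup>2 \<partial>M)" for k
    have v0: "0 \<le> v k" for k
      unfolding v_def by simp
    have q_v: "q k = ennreal (v k)" for k
      unfolding q_def v_def
      by (subst nn_integral_eq_integral[OF int_e2, symmetric])
        (auto simp: ennreal_mult' ennreal_indicator)
    have summable_v: "summable (\<lambda>k. (\<gamma> k)\<^sup>2 * v k)"
    proof (rule bounded_imp_summable)
      fix n
      have "ennreal (\<Sum>k\<le>n. (\<gamma> k)\<^sup>2 * v k) = (\<Sum>k<Suc n. ennreal ((\<gamma> k)\<^sup>2) * q k)"
        unfolding lessThan_Suc_atMost q_v using v0
        by (simp add: sum_ennreal flip: ennreal_mult)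
      also have "\<dots> \<le> ennreal (real m)"
        using sum_q[of "Suc n"] by (simp add: ennreal_of_nat_eq_real_of_nat)
      finally show "(\<Sum>k\<le>n. (\<gamma> k)\<^sup>2 * v k) \<le> real m"
        by simp
    qed (simp add: v0)
    have int_e1: "integrable M (\<lambda>\<omega>. indicator (A k) \<omega> * norm (e k \<omega>))" for k
    proof (rule Bochner_Integration.integrable_bound)
      show "integrable M (\<lambda>\<omega>. 1 + indicator (A k) \<omega> * (norm (e k \<omega>))\<^sup>2)"
        by (intro Bochner_Integration.integrable_add int_e2) simp
      have "x \<le> 1 + x\<^sup>2" for x :: real
        using zero_le_power2[of "x - 1/2"] by (simp add: power2_eq_square algebra_simps)
      then show "AE \<omega> in M. norm (indicator (A k) \<omega> * norm (e k \<omega>))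
          \<le> norm (1 + indicator (A k) \<omega> * (norm (e k \<omega>))\<^sup>2)"
        by (intro AE_I2) (auto simp: indicator_def abs_of_nonneg)
    qed simp
    \<comment> \<open>\<open>B\<close>, \<open>A k\<close> and \<open>d k\<close> are known at time
      \<open>k\<close>, so the conditional mean zero of \<open>e k\<close> kills the product. It is
      expanded over the basis because \<open>real_cond_exp\<close> acts on real functions; the bound
      \<open>D\<close> and \<open>int_e1\<close> give integrability.\<close>
    have cross: "integrable M (\<lambda>\<omega>. indicator (B \<inter> A k) \<omega> * (e k \<omega> \<bullet> d k \<omega>))"
        "(\<integral>\<omega>. indicator (B \<inter> A k) \<omega> * (e k \<omega> \<bullet> d k \<omega>) \<partial>M) = 0"
      if B: "B \<in> sets (Fil k)" for B k
    proof -
      have [measurable]: "B \<in> events" using sub_events[OF B] .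
      define h where "h b \<omega> = indicator (B \<inter> A k) \<omega> * (d k \<omega> \<bullet> b)" for b \<omega>
      have h_Fil: "h b \<in> borel_measurable (Fil k)" for b
        unfolding h_def using A_Fil[of k] B d(1)[of k] by measurable
      have int: "integrable M (\<lambda>\<omega>. h b \<omega> * (e k \<omega> \<bullet> b))" if b: "b \<in> Basis" for b
      proof (rule Bochner_Integration.integrable_bound)
        show "integrable M (\<lambda>\<omega>. D * (indicator (A k) \<omega> * norm (e k \<omega>)))"
          using int_e1 by simp
        show "AE \<omega> in M. norm (h b \<omega> * (e k \<omega> \<bullet> b)) \<le> norm (D * (indicator (A k) \<omega> * norm (e k \<omega>)))"
        proof (rule AE_I2)
          fix \<omega> assume w: "\<omega> \<in> space M"
          have "\<bar>d k \<omega> \<bullet> b\<bar> \<le> D" "\<bar>e k \<omega> \<bullet> b\<bar> \<le> norm (e k \<omega>)"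
            using Basis_le_norm[OF b] d(2)[OF w, of k] order_trans by blast+
          then show "norm (h b \<omega> * (e k \<omega> \<bullet> b)) \<le> norm (D * (indicator (A k) \<omega> * norm (e k \<omega>)))"
            using D0 by (auto simp: h_def indicator_def abs_mult intro!: mult_mono)
        qed
        show "(\<lambda>\<omega>. h b \<omega> * (e k \<omega> \<bullet> b)) \<in> borel_measurable M"
          unfolding h_def by measurable
      qed
      have zero: "(\<integral>\<omega>. h b \<omega> * (e k \<omega> \<bullet> b) \<partial>M) = 0" if b: "b \<in> Basis" for b
      proof -
        have "(\<integral>\<omega>. h b \<omega> * (e k \<omega> \<bullet> b) \<partial>M)
            = (\<integral>\<omega>. h b \<omega> * real_cond_exp M (Fil k) (\<lambda>\<omega>. e k \<omega> \<bullet> b) \<omega> \<partial>M)"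
          by (intro sigma_finite_subalgebra.real_cond_exp_intg(2)[OF sfs, symmetric] int b h_Fil) simp
        also have "\<dots> = (\<integral>\<omega>. 0 \<partial>M)"
        proof (rule integral_cong_AE)
          show "(\<lambda>\<omega>. h b \<omega> * real_cond_exp M (Fil k) (\<lambda>\<omega>. e k \<omega> \<bullet> b) \<omega>) \<in> borel_measurable M"
            unfolding h_def by measurable
          show "AE \<omega> in M. h b \<omega> * real_cond_exp M (Fil k) (\<lambda>\<omega>. e k \<omega> \<bullet> b) \<omega> = 0"
            using e(2)[OF b, of k] by eventually_elim simp
        qed simp
        finally show ?thesis by simp
      qed
      have eq: "indicator (B \<inter> A k) \<omega> * (e k \<omega> \<bullet> d k \<omega>) = (\<Sum>b\<in>Basis. h b \<omega> * (e k \<omega> \<bullet> b))" for \<omega>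
        by (subst euclidean_inner) (simp add: h_def sum_distrib_left ac_simps)
      show "integrable M (\<lambda>\<omega>. indicator (B \<inter> A k) \<omega> * (e k \<omega> \<bullet> d k \<omega>))"
        unfolding eq using int by auto
      show "(\<integral>\<omega>. indicator (B \<inter> A k) \<omega> * (e k \<omega> \<bullet> d k \<omega>) \<partial>M) = 0"
        unfolding eq using int zero by (subst Bochner_Integration.integral_sum) auto
    qed
    define W where "W k \<omega> = indicator (A k) \<omega> * (norm (d k \<omega>))\<^sup>2" for k \<omega>
    have W_Fil: "W k \<in> borel_measurable (Fil k)" for k
      unfolding W_def using A_Fil[of k] d(1)[of k] by measurable
    have W_int: "integrable M (W k)" for k
    proof (rule integrable_const_bound[of _ "D\<^sup>2"])
      show "AE \<omega> in M. norm (W k \<omega>) \<le> D\<^sup>2"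
        using d(2) by (intro AE_I2) (auto simp: W_def indicator_def intro!: power_mono)
      show "W k \<in> borel_measurable M" unfolding W_def by measurable
    qed
    have "AE \<omega> in M. (\<lambda>k. W k \<omega>) \<longlonglongrightarrow> 0"
    proof (rule almost_supermartingale_tendsto_0[OF sub mono W_Fil W_int _ _ _ c])
      show "0 \<le> W k \<omega>" for k \<omega> by (simp add: W_def)
      show "0 \<le> a k + 2 * ((\<gamma> k)\<^sup>2 * v k)" for k using a v0 by simp
      show "summable (\<lambda>k. a k + 2 * ((\<gamma> k)\<^sup>2 * v k))"
        using a summable_v by (intro summable_add summable_mult)
      fix k B assume B: "B \<in> sets (Fil k)"
      have [measurable]: "B \<in> events" using sub_events[OF B] .
      have WB: "integrable M (\<lambda>\<omega>. indicator B \<omega> * W j \<omega>)" for j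
        by (intro integrable_indicator_times W_int) auto
      \<comment> \<open>The terms \<open>a k\<close> and the squared error are kept without the
        indicator of \<open>B\<close>. Both are nonnegative, and their integrals then do not depend
        on \<open>B\<close>.\<close>
      let ?R = "\<lambda>\<omega>. (1 - c k) * (indicator B \<omega> * W k \<omega>) + a k
          + 2 * (\<gamma> k)\<^sup>2 * (indicator (A k) \<omega> * (norm (e k \<omega>))\<^sup>2)
          - 2 * \<gamma> k * (indicator (B \<inter> A k) \<omega> * (e k \<omega> \<bullet> d k \<omega>))"
      have "(\<integral>\<omega>. indicator B \<omega> * W (Suc k) \<omega> \<partial>M) \<le> (\<integral>\<omega>. ?R \<omega> \<partial>M)"
      proof (rule integral_mono[OF WB])
        show "integrable M ?R"
          by (intro Bochner_Integration.integrable_diff Bochner_Integration.integrable_add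
              integrable_mult_right WB int_e2 cross(1) B integrable_const)
        fix \<omega> assume w: "\<omega> \<in> space M"
        show "indicator B \<omega> * W (Suc k) \<omega> \<le> ?R \<omega>"
        proof (cases "\<omega> \<in> B \<inter> A k")
          case True
          have "indicator B \<omega> * W (Suc k) \<omega> \<le> (norm (d (Suc k) \<omega>))\<^sup>2"
            by (simp add: W_def indicator_def)
          with step[OF w, of k] True show ?thesis by (simp add: W_def)
        next
          case False
          \<comment> \<open>The events \<open>A k\<close> decrease: a path cut off at time
            \<open>k\<close> is cut off at the next time too.\<close>
          then have "\<omega> \<notin> B \<or> \<omega> \<notin> A k \<and> \<omega> \<notin> A (Suc k)"
            using A_Suc[of k] by blast
          then have zero: "indicator B \<omega> * W (Suc k) \<omega> = 0" "indicator B \<omega> * W k \<omega> = 0"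
            by (auto simp: W_def)
          show ?thesis unfolding zero using False a(1)[of k] by simp
        qed
      qed
      also have "\<dots> = (1 - c k) * (\<integral>\<omega>. indicator B \<omega> * W k \<omega> \<partial>M) + a k
          + 2 * (\<gamma> k)\<^sup>2 * v k"
        using WB int_e2[of k] cross[OF B] by (simp add: prob_space flip: v_def)
      finally show "(\<integral>\<omega>. indicator B \<omega> * W (Suc k) \<omega> \<partial>M)
          \<le> (1 - c k) * (\<integral>\<omega>. indicator B \<omega> * W k \<omega> \<partial>M) + (a k + 2 * ((\<gamma> k)\<^sup>2 * v k))"
        by simp
    qed
    then show ?thesis
      using AE_space
    proof eventually_elim
      case (elim \<omega>)
      show ?case
      proof
        assume "\<forall>k. (\<Sum>j\<le>k. ennreal ((\<gamma> j)\<^sup>2) * C j \<omega>) \<le> of_nat m"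
        with elim(2) have "W k \<omega> = (norm (d k \<omega>))\<^sup>2" for k
          by (simp add: W_def A_def S_def)
        with elim(1) have "(\<lambda>k. (norm (d k \<omega>))\<^sup>2) \<longlonglongrightarrow> 0" by simp
        then have "(\<lambda>k. sqrt ((norm (d k \<omega>))\<^sup>2)) \<longlonglongrightarrow> sqrt 0" by (rule tendsto_real_sqrt)
        then show "(\<lambda>k. d k \<omega>) \<longlonglongrightarrow> 0" by (simp add: tendsto_norm_zero_iff)
      qed
    qed
  qed
  have "AE \<omega> in M. \<forall>m::nat. (\<forall>k. (\<Sum>j\<le>k. ennreal ((\<gamma> j)\<^sup>2) * C j \<omega>) \<le> of_nat m)
      \<longrightarrow> (\<lambda>k. d k \<omega>) \<longlonglongrightarrow> 0"
    by (intro AE_all_countable[THEN iffD2] allI localized)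
  with e(3) show ?thesis
  proof eventually_elim
    case (elim \<omega>)
    define s where "s = (\<Sum>k. ennreal ((\<gamma> k)\<^sup>2) * C k \<omega>)"
    have "s < \<infinity>" using elim(1) by (simp add: s_def C_def)
    then obtain r where r: "0 \<le> r" "s = ennreal r" by (cases s) auto
    \<comment> \<open>Any level above the finite total \<open>s\<close> is never exceeded, so the
      localized statement for this \<open>m\<close> applies to the path.\<close>
    obtain m :: nat where "r \<le> real m" using real_arch_simple by blast
    then have "s \<le> of_nat m" using r by (simp add: ennreal_of_nat_eq_real_of_nat)
    moreover have "(\<Sum>j\<le>k. ennreal ((\<gamma> j)\<^sup>2) * C j \<omega>) \<le> s" for k
      unfolding s_def by (intro sum_le_suminf) auto
    ultimately show ?case using elim(2) order_trans by blast
  qed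
qed

end

subsection \<open>Convergence of the stochastic forward-backward iteration\<close>

lemma subalgebra_history:
  assumes "x0 \<in> borel_measurable M" "\<And>j. \<xi>s j \<in> borel_measurable M"
  shows "subalgebra M (history M x0 \<xi>s k)"
  unfolding subalgebra_def history_def
  by (subst sets_measure_of)
    (auto simp: space_measure_of_conv intro!: sets.sigma_sets_subset
      intro: measurable_sets[OF assms(1)] measurable_sets[OF assms(2)])

lemma history_mono:
  assumes "j \<le> k"
  shows "subalgebra (history M x0 \<xi>s k) (history M x0 \<xi>s j)"
proof -
  have "sets (history M x0 \<xi>s j) \<subseteq> sets (history M x0 \<xi>s k)"
    unfolding history_def using assms
    by (subst (1 2) sets_measure_of) (auto intro!: sigma_sets_mono' dest: less_le_trans)
  then show ?thesis by (simp add: subalgebra_def history_def space_measure_of_conv)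
qed

text \<open>Expand the square. Monotonicity controls the product of \<open>u\<close> and
  \<open>d\<close>, and the parallelogram identity separates the Lipschitz part \<open>u\<close>
  from the noise \<open>e\<close> in the second-order term.\<close>

lemma noisy_gradient_step_bound:
  fixes d u e :: "'a::real_inner"
  assumes "\<mu> * (norm d)\<^sup>2 \<le> u \<bullet> d" "norm u \<le> L * norm d" "0 \<le> t"
  shows "(norm (d - t *\<^sub>R (u + e)))\<^sup>2 \<le> (1 - 2 * \<mu> * t) * (norm d)\<^sup>2
    + 2 * t\<^sup>2 * L\<^sup>2 * (norm d)\<^sup>2 + 2 * t\<^sup>2 * (norm e)\<^sup>2 - 2 * t * (e \<bullet> d)"
proof -
  have "(norm (u + e))\<^sup>2 = 2 * (norm u)\<^sup>2 + 2 * (norm e)\<^sup>2 - (norm (u - e))\<^sup>2"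
    unfolding power2_norm_eq_inner by (simp add: algebra_simps inner_commute)
  also have "\<dots> \<le> 2 * (L * norm d)\<^sup>2 + 2 * (norm e)\<^sup>2"
    using power_mono[OF assms(2), of 2] zero_le_power2[of "norm (u - e)"] by (smt (verit) norm_ge_zero)
  finally have "t\<^sup>2 * (norm (u + e))\<^sup>2 \<le> t\<^sup>2 * (2 * (L * norm d)\<^sup>2 + 2 * (norm e)\<^sup>2)"
    by (rule mult_left_mono) simp
  moreover have "2 * t * (\<mu> * (norm d)\<^sup>2) \<le> 2 * t * (u \<bullet> d)"
    using assms(1,3) by (intro mult_left_mono) auto
  moreover have "(norm (d - t *\<^sub>R (u + e)))\<^sup>2
      = (norm d)\<^sup>2 - 2 * t * (u \<bullet> d) - 2 * t * (e \<bullet> d) + t\<^sup>2 * (norm (u + e))\<^sup>2"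
    unfolding power2_norm_eq_inner
    by (simp add: algebra_simps inner_commute power2_eq_square)
  ultimately show ?thesis
    by (simp add: algebra_simps power_mult_distrib)
qed

theorem theorem1:
  fixes M :: "'w measure"
    and own :: "'n::finite \<Rightarrow> 'i::finite"
    and \<Omega> :: "'i \<Rightarrow> (real ^ 'n) set"
    and f :: "'i \<Rightarrow> real ^ 'n \<Rightarrow> real ^ 'd::finite \<Rightarrow> real"
    and g :: "'i \<Rightarrow> real ^ 'n \<Rightarrow> ereal"
    and lip :: "'i \<Rightarrow> real ^ 'n \<Rightarrow> real ^ 'd \<Rightarrow> real"
    and \<xi> :: "'w \<Rightarrow> real ^ 'd ^ 'i"
    and \<xi>s :: "nat \<Rightarrow> 'w \<Rightarrow> real ^ 'd ^ 'i"
    and x :: "nat \<Rightarrow> 'w \<Rightarrow> real ^ 'n"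
    and \<gamma> :: "nat \<Rightarrow> real"
    and xstar :: "real ^ 'n"
    and \<mu> L :: real
  defines "F \<equiv> pseudogradient M own f \<xi>"
    and "\<epsilon> \<equiv> sa_error M own f \<xi> \<xi>s x"
    and "\<F> \<equiv> history M (x 0) \<xi>s"
  assumes "prob_space M"
    and "\<xi> \<in> borel_measurable M"
    \<comment> \<open>the expected-value functions\<close>
    and "\<And>i u y. u \<in> block own i \<Longrightarrow> y \<in> others_set own \<Omega> i \<Longrightarrow>
           integrable M (\<lambda>\<omega>. f i (u + y) (\<xi> \<omega> $ i))"
    and "\<And>i y. y \<in> others_set own \<Omega> i \<Longrightarrow>
           convex_on (block own i) (\<lambda>u. integral\<^sup>L M (\<lambda>\<omega>. f i (u + y) (\<xi> \<omega> $ i)))"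
    and "\<And>i y. y \<in> others_set own \<Omega> i \<Longrightarrow>
           C1_on (block own i) (\<lambda>u. integral\<^sup>L M (\<lambda>\<omega>. f i (u + y) (\<xi> \<omega> $ i)))"
    \<comment> \<open>the sample functions\<close>
    and "\<And>i y s. y \<in> others_set own \<Omega> i \<Longrightarrow> convex_on (block own i) (\<lambda>u. f i (u + y) s)"
    and "\<And>i y s. y \<in> others_set own \<Omega> i \<Longrightarrow>
           (lip i y s)-lipschitz_on (block own i) (\<lambda>u. f i (u + y) s)"
    and "\<And>i y s. y \<in> others_set own \<Omega> i \<Longrightarrow> C1_on (block own i) (\<lambda>u. f i (u + y) s)"
    and "\<And>i u y. u \<in> block own i \<Longrightarrow> y \<in> others_set own \<Omega> i \<Longrightarrow>
           (\<lambda>s. f i (u + y) s) \<in> borel_measurable borel"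
    and "\<And>i y. y \<in> others_set own \<Omega> i \<Longrightarrow>
           integrable (distr M borel (\<lambda>\<omega>. \<xi> \<omega> $ i)) (lip i y)"
    \<comment> \<open>the nonsmooth terms and the local decision sets\<close>
    and "\<And>i u. u \<in> block own i \<Longrightarrow> g i u \<noteq> -\<infinity>"
    and "\<And>i. lsc_on (block own i) (g i)"
    and "\<And>i. convex_ereal_on (block own i) (g i)"
    and "\<And>i. dom_on (block own i) (g i) = \<Omega> i"
    and "\<And>i. \<Omega> i \<noteq> {}"
    and "\<And>i. compact (\<Omega> i)"
    and "\<And>i. convex (\<Omega> i)"
    \<comment> \<open>the samples and the algorithm\<close>
    and "prob_space.indep_vars M (\<lambda>_. borel) \<xi>s UNIV"
    and "\<And>k. distr M borel (\<xi>s k) = distr M borel \<xi>"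
    and "\<And>k. \<gamma> k > 0"
    and "x 0 \<in> borel_measurable M"
    and "\<And>\<omega> i. \<omega> \<in> space M \<Longrightarrow> part own i (x 0 \<omega>) \<in> \<Omega> i"
    and "\<And>k \<omega> i. \<omega> \<in> space M \<Longrightarrow>
           part own i (x (Suc k) \<omega>) =
             prox (block own i) (\<lambda>u. ereal (\<gamma> k) * g i u)
               (part own i (x k \<omega>) - \<gamma> k *\<^sub>R part own i (F_SA own f (x k \<omega>) (\<xi>s k \<omega>)))"
    and "\<And>k. x k \<in> borel_measurable (\<F> k)"
    and "\<And>k. \<epsilon> k \<in> borel_measurable M"
    and "xstar \<in> SOL own \<Omega> F g"
    \<comment> \<open>(i)\<close>
    and "\<And>k c. AE \<omega> in M. real_cond_exp M (\<F> k) (\<lambda>\<omega>. \<epsilon> k \<omega> $ c) \<omega> = 0"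
    \<comment> \<open>(ii)\<close>
    and "filterlim (\<lambda>n. \<Sum>k<n. \<gamma> k) at_top sequentially"
    and "summable (\<lambda>k. (\<gamma> k)\<^sup>2)"
    and "AE \<omega> in M. (\<Sum>k. ennreal ((\<gamma> k)\<^sup>2) *
           nn_cond_exp M (\<F> k) (\<lambda>\<omega>. ennreal ((norm (\<epsilon> k \<omega>))\<^sup>2)) \<omega>) < \<infinity>"
    \<comment> \<open>(iii)\<close>
    and "\<mu> > 0"
    and "\<And>z. z \<in> joint_set own \<Omega> \<Longrightarrow>
           (F z - F xstar) \<bullet> (z - xstar) \<ge> \<mu> * (norm (z - xstar))\<^sup>2"
    \<comment> \<open>(iv)\<close>
    and "L > 0"
    and "\<And>z. z \<in> joint_set own \<Omega> \<Longrightarrow> norm (F z - F xstar) \<le> L * norm (z - xstar)"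
  shows "AE \<omega> in M. \<exists>z\<in>SOL own \<Omega> F g. (\<lambda>k. x k \<omega>) \<longlonglongrightarrow> z"
proof -
  interpret prob_space M by (rule assms)
  note \<gamma> = \<open>\<And>k. \<gamma> k > 0\<close>
  note sol = \<open>xstar \<in> SOL own \<Omega> F g\<close>
  have "random_variable borel (\<xi>s j)" for j
    using \<open>indep_vars (\<lambda>_. borel) \<xi>s UNIV\<close> by (simp add: indep_vars_def)
  then have sub: "subalgebra M (\<F> k)" for k
    unfolding \<F>_def by (intro subalgebra_history \<open>x 0 \<in> borel_measurable M\<close>)
  have step: "x (Suc k) \<omega> \<in> joint_set own \<Omega>"
      "norm (x (Suc k) \<omega> - xstar)
        \<le> norm (x k \<omega> - xstar - \<gamma> k *\<^sub>R (F_SA own f (x k \<omega>) (\<xi>s k \<omega>) - F xstar))"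
    if "\<omega> \<in> space M" for k \<omega>
    using forward_backward_step[OF assms(14-20) \<gamma> assms(26)[OF that] sol] by auto
  \<comment> \<open>The initial point is feasible by hypothesis, every later one because it is a
    proximal point.\<close>
  have in_joint: "x k \<omega> \<in> joint_set own \<Omega>" if "\<omega> \<in> space M" for k \<omega>
    using step(1)[OF that] assms(25)[OF that] by (cases k) (auto simp: joint_set_def)
  have "bounded (joint_set own \<Omega>)"
    by (intro bounded_joint_set compact_imp_bounded assms)
  then obtain R where R: "\<And>z. z \<in> joint_set own \<Omega> \<Longrightarrow> norm z \<le> R"
    by (auto simp: bounded_iff)
  \<comment> \<open>Compactness keeps all iterates within distance \<open>D\<close> of
    \<open>xstar\<close>. This bounds the process and turns the Lipschitz term of the recursion into
    the deterministic summable sequence \<open>a\<close>.\<close>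
  define D where "D = R + norm xstar"
  have D: "norm (x k \<omega> - xstar) \<le> D" if "\<omega> \<in> space M" for k \<omega>
    unfolding D_def using R[OF in_joint[OF that]] by (meson add_right_mono norm_triangle_ineq4 order_trans)
  have "AE \<omega> in M. (\<lambda>k. x k \<omega> - xstar) \<longlonglongrightarrow> 0"
  proof (rule stochastic_descent_tendsto_0[where Fil=\<F> and e=\<epsilon> and \<gamma>=\<gamma> and D=D
        and a="\<lambda>k. 2 * (\<gamma> k)\<^sup>2 * L\<^sup>2 * D\<^sup>2" and c="\<lambda>k. 2 * \<mu> * \<gamma> k"])
    show "subalgebra (\<F> k) (\<F> j)" if "j \<le> k" for j k
      unfolding \<F>_def using that by (rule history_mono)
    show "(\<lambda>\<omega>. x k \<omega> - xstar) \<in> borel_measurable (\<F> k)" for k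
      using \<open>\<And>k. x k \<in> borel_measurable (\<F> k)\<close> by (intro borel_measurable_diff) auto
    \<comment> \<open>The basis vectors are coordinate axes, so this is the coordinatewise
      hypothesis (i).\<close>
    show "AE \<omega> in M. real_cond_exp M (\<F> k) (\<lambda>\<omega>. \<epsilon> k \<omega> \<bullet> b) \<omega> = 0" if "b \<in> Basis" for k b
      using that assms(30)[of k] by (auto simp: Basis_vec_def inner_axis)
    show "summable (\<lambda>k. 2 * (\<gamma> k)\<^sup>2 * L\<^sup>2 * D\<^sup>2)"
      using \<open>summable (\<lambda>k. (\<gamma> k)\<^sup>2)\<close> by (intro summable_mult summable_mult2)
    have "filterlim (\<lambda>n. 2 * \<mu> * (\<Sum>k<n. \<gamma> k)) at_top sequentially"
      using \<open>\<mu> > 0\<close> by (intro filterlim_tendsto_pos_mult_at_top[OF tendsto_const _ assms(31)]) simp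
    then show "filterlim (\<lambda>n. \<Sum>k<n. 2 * \<mu> * \<gamma> k) at_top sequentially"
      by (simp add: sum_distrib_left)
    show "(norm (x (Suc k) \<omega> - xstar))\<^sup>2 \<le> (1 - 2 * \<mu> * \<gamma> k) * (norm (x k \<omega> - xstar))\<^sup>2
        + 2 * (\<gamma> k)\<^sup>2 * L\<^sup>2 * D\<^sup>2 + 2 * (\<gamma> k)\<^sup>2 * (norm (\<epsilon> k \<omega>))\<^sup>2
        - 2 * \<gamma> k * (\<epsilon> k \<omega> \<bullet> (x k \<omega> - xstar))" if w: "\<omega> \<in> space M" for k \<omega>
    proof -
      let ?d = "x k \<omega> - xstar" and ?u = "F (x k \<omega>) - F xstar"
      \<comment> \<open>Adding and subtracting \<open>F (x k \<omega>)\<close> splits the step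
        direction into the part covered by (iii) and (iv) and the stochastic error.\<close>
      have "F_SA own f (x k \<omega>) (\<xi>s k \<omega>) - F xstar = ?u + \<epsilon> k \<omega>"
        unfolding \<epsilon>_def sa_error_def F_def by simp
      from step(2)[OF w, of k, unfolded this]
      have "(norm (x (Suc k) \<omega> - xstar))\<^sup>2 \<le> (norm (?d - \<gamma> k *\<^sub>R (?u + \<epsilon> k \<omega>)))\<^sup>2"
        by (rule power_mono) simp
      also have "\<dots> \<le> (1 - 2 * \<mu> * \<gamma> k) * (norm ?d)\<^sup>2
          + 2 * (\<gamma> k)\<^sup>2 * L\<^sup>2 * (norm ?d)\<^sup>2 + 2 * (\<gamma> k)\<^sup>2 * (norm (\<epsilon> k \<omega>))\<^sup>2
          - 2 * \<gamma> k * (\<epsilon> k \<omega> \<bullet> ?d)"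
        by (intro noisy_gradient_step_bound assms(35) assms(37) in_joint w less_imp_le \<gamma>)
      also have "2 * (\<gamma> k)\<^sup>2 * L\<^sup>2 * (norm ?d)\<^sup>2 \<le> 2 * (\<gamma> k)\<^sup>2 * L\<^sup>2 * D\<^sup>2"
        using D[OF w] by (intro mult_left_mono power_mono) auto
      finally show ?thesis by simp
    qed
  qed (use sub D \<gamma> \<open>\<mu> > 0\<close> \<open>\<And>k. \<epsilon> k \<in> borel_measurable M\<close> assms(33) in \<open>auto simp: less_imp_le\<close>)
  then show ?thesis
    by eventually_elim (use sol in \<open>auto simp: LIM_zero_iff\<close>)
qed

end
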